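(* Let $S$ be a unital associative ring, $\sigma$ an injective endomorphism of $S$, and $\delta$ a left $\sigma$-derivation of $S$. Let $f(t)=a_mt^m-\sum_{i=0}^{m-1}a_it^i\in R=S[t;\sigma,\delta]$ and suppose $a_m$ is invertible in $S$. (i) For all $g(t)\in R$ there exist uniquely determined $r(t),q(t)\in R$ with $\deg(r(t))<m$ such that $g(t)=q(t)f(t)+r(t)$. (ii) Suppose additionally that $\sigma$ is an automorphism of $S$. Then for all $g(t)\in R$ there exist uniquely determined $r(t),q(t)\in R$ with $\deg(r(t))<m$ such that $g(t)=f(t)q(t)+r(t)$.
   Context: A left $\sigma$-derivation is an additive map $\delta:S\to S$ with $\delta(ab)=\sigma(a)\delta(b)+\delta(a)b$ for all $a,b\in S$. $S[t;\sigma,\delta]$ is the skew polynomial ring: left polynomials $\sum a_it^i$ with $a_i\in S$, termwise addition, and associative multiplication determined by $ta=\sigma(a)t+\delta(a)$ for $a\in S$. The degree of $0$ is $-\infty$. An element is invertible if it has a two-sided inverse. *)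

theory Defs
  imports "HOL-Computational_Algebra.Polynomial"
begin

text \<open>
  Unital associative rings are types of sort \<open>{ring, monoid_mult}\<close>; unlike \<open>ring_1\<close>,
  this sort does not exclude the zero ring.
\<close>

definition ring_endomorphism :: "('a::{ring,monoid_mult} \<Rightarrow> 'a) \<Rightarrow> bool" where
  "ring_endomorphism \<sigma> \<longleftrightarrow>
     Modules.additive \<sigma> \<and> (\<forall>a b. \<sigma> (a * b) = \<sigma> a * \<sigma> b) \<and> \<sigma> 1 = 1"

definition left_skew_derivation ::
    "('a::{ring,monoid_mult} \<Rightarrow> 'a) \<Rightarrow> ('a \<Rightarrow> 'a) \<Rightarrow> bool" where
  "left_skew_derivation \<sigma> \<delta> \<longleftrightarrow>
     Modules.additive \<delta> \<and> (\<forall>a b. \<delta> (a * b) = \<sigma> a * \<delta> b + \<delta> a * b)"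

definition two_sided_invertible :: "'a::{ring,monoid_mult} \<Rightarrow> bool" where
  "two_sided_invertible a \<longleftrightarrow> (\<exists>b. a * b = 1 \<and> b * a = 1)"

text \<open>
  The elements of \<open>S[t;\<sigma>,\<delta>]\<close> are the left polynomials over \<open>S\<close>, represented by the type
  \<open>'a poly\<close> with its termwise addition (the library product on \<open>'a poly\<close> is the one with
  central \<open>t\<close>, and is not used). From \<open>ta = \<sigma>(a)t + \<delta>(a)\<close>, left multiplication by \<open>t\<close> sends
  \<open>\<Sum> b\<^sub>j t\<^sup>j\<close> to \<open>\<Sum> \<sigma>(b\<^sub>j) t\<^sup>j\<^sup>+\<^sup>1 + \<Sum> \<delta>(b\<^sub>j) t\<^sup>j\<close>; the product \<open>pq\<close> is then
  \<open>\<Sum> p\<^sub>i (t\<^sup>i q)\<close>.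
\<close>

definition left_scale :: "'a::{ring,monoid_mult} \<Rightarrow> 'a poly \<Rightarrow> 'a poly" where
  "left_scale a p = map_poly (\<lambda>x. a * x) p"

definition left_mult_t ::
    "('a::{ring,monoid_mult} \<Rightarrow> 'a) \<Rightarrow> ('a \<Rightarrow> 'a) \<Rightarrow> 'a poly \<Rightarrow> 'a poly" where
  "left_mult_t \<sigma> \<delta> p = pCons 0 (map_poly \<sigma> p) + map_poly \<delta> p"

definition skew_mult ::
    "('a::{ring,monoid_mult} \<Rightarrow> 'a) \<Rightarrow> ('a \<Rightarrow> 'a) \<Rightarrow> 'a poly \<Rightarrow> 'a poly \<Rightarrow> 'a poly" where
  "skew_mult \<sigma> \<delta> p q =
     (\<Sum>i\<le>degree p. left_scale (coeff p i) ((left_mult_t \<sigma> \<delta> ^^ i) q))"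

text \<open>
  The following facts confirm that this multiplication is the one of \<open>S[t;\<sigma>,\<delta>]\<close>: it is
  biadditive, associative and unital, extends the multiplication of \<open>S\<close>, satisfies
  \<open>ta = \<sigma>(a)t + \<delta>(a)\<close>, and \<open>monom a n\<close> is \<open>a t\<^sup>n\<close>.
\<close>

lemma coeff_left_scale: "coeff (left_scale a p) n = a * coeff p n"
  by (simp add: left_scale_def coeff_map_poly)

lemma left_scale_add_right: "left_scale a (p + q) = left_scale a p + left_scale a q"
  by (simp add: poly_eq_iff coeff_left_scale algebra_simps)

lemma left_scale_add_left: "left_scale (a + b) p = left_scale a p + left_scale b p"
  by (simp add: poly_eq_iff coeff_left_scale algebra_simps)

lemma left_scale_0_left [simp]: "left_scale 0 p = 0"
  by (simp add: poly_eq_iff coeff_left_scale)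

lemma left_scale_0_right [simp]: "left_scale a 0 = 0"
  by (simp add: poly_eq_iff coeff_left_scale)

lemma left_scale_1 [simp]: "left_scale 1 p = p"
  by (simp add: poly_eq_iff coeff_left_scale)

lemma left_scale_left_scale: "left_scale a (left_scale b p) = left_scale (a * b) p"
  by (simp add: poly_eq_iff coeff_left_scale mult.assoc)

lemma left_scale_sum: "left_scale a (sum h A) = (\<Sum>i\<in>A. left_scale a (h i))"
  by (induction A rule: infinite_finite_induct) (simp_all add: left_scale_add_right)

lemma skew_mult_bound:
  assumes "degree p \<le> n"
  shows "skew_mult \<sigma> \<delta> p q =
           (\<Sum>i\<le>n. left_scale (coeff p i) ((left_mult_t \<sigma> \<delta> ^^ i) q))"
  unfolding skew_mult_def
  using assms by (intro sum.mono_neutral_left) (auto simp: coeff_eq_0)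

lemma skew_mult_add_left:
  "skew_mult \<sigma> \<delta> (p + q) r = skew_mult \<sigma> \<delta> p r + skew_mult \<sigma> \<delta> q r"
proof -
  define n where "n = max (degree p) (degree q)"
  have "degree p \<le> n" "degree q \<le> n" "degree (p + q) \<le> n"
    by (auto simp: n_def degree_add_le)
  then show ?thesis
    by (simp add: skew_mult_bound left_scale_add_left sum.distrib)
qed

lemma skew_mult_0_left [simp]: "skew_mult \<sigma> \<delta> 0 q = 0"
  by (simp add: skew_mult_def)

lemma skew_mult_sum_left:
  "skew_mult \<sigma> \<delta> (sum h A) q = (\<Sum>i\<in>A. skew_mult \<sigma> \<delta> (h i) q)"
  by (induction A rule: infinite_finite_induct) (simp_all add: skew_mult_add_left)

lemma skew_mult_left_scale:
  "skew_mult \<sigma> \<delta> (left_scale a p) q = left_scale a (skew_mult \<sigma> \<delta> p q)"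
proof -
  have "degree (left_scale a p) \<le> degree p"
    by (intro degree_le) (simp add: coeff_left_scale coeff_eq_0)
  then show ?thesis
    by (simp add: skew_mult_bound[of _ "degree p"] coeff_left_scale left_scale_sum
        left_scale_left_scale)
qed

lemma skew_mult_const_left: "skew_mult \<sigma> \<delta> [:a:] q = left_scale a q"
  by (simp add: skew_mult_def)

lemma skew_mult_one_left: "skew_mult \<sigma> \<delta> [:1:] q = q"
  by (simp add: skew_mult_const_left)

lemma skew_mult_const_const: "skew_mult \<sigma> \<delta> [:a:] [:b:] = [:a * b:]"
  by (simp add: skew_mult_const_left left_scale_def map_poly_pCons)

context
  fixes \<sigma> \<delta> :: "'a::{ring,monoid_mult} \<Rightarrow> 'a"
  assumes endo: "ring_endomorphism \<sigma>" and deriv: "left_skew_derivation \<sigma> \<delta>"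
begin

interpretation s: Modules.additive \<sigma>
  using endo by (simp add: ring_endomorphism_def)

interpretation d: Modules.additive \<delta>
  using deriv by (simp add: left_skew_derivation_def)

lemma s_mult: "\<sigma> (a * b) = \<sigma> a * \<sigma> b" and s_one: "\<sigma> 1 = 1"
  using endo by (simp_all add: ring_endomorphism_def)

lemma d_mult: "\<delta> (a * b) = \<sigma> a * \<delta> b + \<delta> a * b"
  using deriv by (simp add: left_skew_derivation_def)

lemma d_one: "\<delta> 1 = 0"
  using d_mult[of 1 1] by (simp add: s_one)

lemma coeff_left_mult_t:
  "coeff (left_mult_t \<sigma> \<delta> p) n =
     (case n of 0 \<Rightarrow> 0 | Suc k \<Rightarrow> \<sigma> (coeff p k)) + \<delta> (coeff p n)"
  by (simp add: left_mult_t_def coeff_pCons coeff_map_poly s.zero d.zero split: nat.split)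

lemma left_mult_t_add:
  "left_mult_t \<sigma> \<delta> (p + q) = left_mult_t \<sigma> \<delta> p + left_mult_t \<sigma> \<delta> q"
  by (simp add: poly_eq_iff coeff_left_mult_t s.add d.add split: nat.split)

lemma left_mult_t_0: "left_mult_t \<sigma> \<delta> 0 = 0"
  by (simp add: left_mult_t_def)

lemma left_mult_t_sum: "left_mult_t \<sigma> \<delta> (sum h A) = (\<Sum>i\<in>A. left_mult_t \<sigma> \<delta> (h i))"
  by (induction A rule: infinite_finite_induct) (simp_all add: left_mult_t_add left_mult_t_0)

lemma left_mult_t_left_scale:
  "left_mult_t \<sigma> \<delta> (left_scale a p) =
     left_scale (\<sigma> a) (left_mult_t \<sigma> \<delta> p) + left_scale (\<delta> a) p"
  by (simp add: poly_eq_iff coeff_left_mult_t coeff_left_scale s_mult d_mult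
      algebra_simps split: nat.split)

lemma left_mult_t_pow_add:
  "(left_mult_t \<sigma> \<delta> ^^ i) (p + q) = (left_mult_t \<sigma> \<delta> ^^ i) p + (left_mult_t \<sigma> \<delta> ^^ i) q"
  by (induction i) (simp_all add: left_mult_t_add)

lemma skew_mult_add_right:
  "skew_mult \<sigma> \<delta> p (q + r) = skew_mult \<sigma> \<delta> p q + skew_mult \<sigma> \<delta> p r"
  by (simp add: skew_mult_def left_mult_t_pow_add left_scale_add_right sum.distrib)

lemma skew_mult_left_mult_t:
  "skew_mult \<sigma> \<delta> (left_mult_t \<sigma> \<delta> p) q = left_mult_t \<sigma> \<delta> (skew_mult \<sigma> \<delta> p q)"
proof -
  let ?T = "left_mult_t \<sigma> \<delta>"
  define n where "n = degree p"
  have 1: "degree (?T p) \<le> Suc n"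
    by (intro degree_le) (auto simp: coeff_left_mult_t coeff_eq_0 n_def s.zero d.zero split: nat.split)
  have 2: "coeff p (Suc n) = 0"
    by (simp add: n_def coeff_eq_0)
  have "skew_mult \<sigma> \<delta> (?T p) q =
      (\<Sum>i\<le>Suc n. left_scale (case i of 0 \<Rightarrow> 0 | Suc k \<Rightarrow> \<sigma> (coeff p k)) ((?T ^^ i) q))
      + (\<Sum>i\<le>Suc n. left_scale (\<delta> (coeff p i)) ((?T ^^ i) q))"
    unfolding skew_mult_bound[OF 1] coeff_left_mult_t left_scale_add_left sum.distrib ..
  also have "(\<Sum>i\<le>Suc n. left_scale (case i of 0 \<Rightarrow> 0 | Suc k \<Rightarrow> \<sigma> (coeff p k)) ((?T ^^ i) q))
      = (\<Sum>i\<le>n. left_scale (\<sigma> (coeff p i)) (?T ((?T ^^ i) q)))"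
    by (subst sum.atMost_Suc_shift) simp
  also have "(\<Sum>i\<le>Suc n. left_scale (\<delta> (coeff p i)) ((?T ^^ i) q))
      = (\<Sum>i\<le>n. left_scale (\<delta> (coeff p i)) ((?T ^^ i) q))"
    by (simp add: 2 d.zero)
  finally show ?thesis
    by (simp add: skew_mult_def n_def left_mult_t_sum left_mult_t_left_scale sum.distrib)
qed

lemma skew_mult_assoc:
  "skew_mult \<sigma> \<delta> (skew_mult \<sigma> \<delta> p q) r = skew_mult \<sigma> \<delta> p (skew_mult \<sigma> \<delta> q r)"
proof -
  let ?T = "left_mult_t \<sigma> \<delta>"
  have pow: "skew_mult \<sigma> \<delta> ((?T ^^ i) q) r = (?T ^^ i) (skew_mult \<sigma> \<delta> q r)" for i
    by (induction i) (simp_all add: skew_mult_left_mult_t)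
  show ?thesis
    unfolding skew_mult_def[of \<sigma> \<delta> p]
    by (simp add: skew_mult_sum_left skew_mult_left_scale pow)
qed

lemma left_mult_t_monom_1: "left_mult_t \<sigma> \<delta> (monom 1 n) = monom 1 (Suc n)"
  by (auto simp: poly_eq_iff coeff_left_mult_t s_one d_one s.zero d.zero split: nat.split)

lemma left_mult_t_pow_monom_1:
  "(left_mult_t \<sigma> \<delta> ^^ i) (monom 1 n) = monom 1 (i + n)"
  by (induction i) (simp_all add: left_mult_t_monom_1)

lemma skew_mult_monom_left:
  "skew_mult \<sigma> \<delta> (monom a n) q = left_scale a ((left_mult_t \<sigma> \<delta> ^^ n) q)"
proof -
  have "skew_mult \<sigma> \<delta> (monom a n) q =
      (\<Sum>i\<le>n. left_scale (if n = i then a else 0) ((left_mult_t \<sigma> \<delta> ^^ i) q))"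
    by (simp add: skew_mult_bound[OF degree_monom_le])
  also have "\<dots> = (\<Sum>i\<le>n. if n = i then left_scale a ((left_mult_t \<sigma> \<delta> ^^ i) q) else 0)"
    by (intro sum.cong) auto
  finally show ?thesis by simp
qed

lemma skew_mult_monom_t: "skew_mult \<sigma> \<delta> (monom a n) (monom 1 1) = monom a (Suc n)"
  by (simp add: skew_mult_monom_left left_mult_t_pow_monom_1 poly_eq_iff coeff_left_scale)

lemma skew_mult_one_right: "skew_mult \<sigma> \<delta> p [:1:] = p"
proof -
  have "skew_mult \<sigma> \<delta> p [:1:] = (\<Sum>i\<le>degree p. monom (coeff p i) i)"
    by (simp add: skew_mult_def monom_0[symmetric] left_mult_t_pow_monom_1)
      (intro sum.cong, auto simp: poly_eq_iff coeff_left_scale)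
  then show ?thesis by (simp add: poly_as_sum_of_monoms)
qed

lemma skew_mult_t_const:
  "skew_mult \<sigma> \<delta> (monom 1 1) [:a:] = skew_mult \<sigma> \<delta> [:\<sigma> a:] (monom 1 1) + [:\<delta> a:]"
  by (auto simp: skew_mult_monom_left skew_mult_const_left poly_eq_iff coeff_left_scale
      coeff_left_mult_t coeff_pCons s.zero d.zero split: nat.split)

end

end

theory Submission imports Defs begin

text \<open>
  Let \<open>p\<close> have no coefficients above \<open>k\<close> and \<open>q\<close> none above \<open>n\<close>. Then \<open>p q\<close> has none above
  \<open>k + n\<close>, and the coefficient of \<open>p q\<close> at \<open>k + n\<close> is
  \<open>p\<^sub>k \<sigma>\<^sup>k(q\<^sub>n)\<close>: moving a scalar to the left past \<open>t\<^sup>k\<close> applies \<open>\<sigma>\<^sup>k\<close> to it, and \<open>\<delta>\<close>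
  affects only lower coefficients (lemma \<open>skew_mult_top_coeff\<close>).

  Hence both maps \<open>q \<mapsto> q f\<close> and \<open>q \<mapsto> f q\<close> are additive, raise the degree bound by \<open>m\<close>, and act
  on the top coefficient \<open>b = q\<^sub>n\<close> by \<open>b \<mapsto> b \<sigma>\<^sup>n(a\<^sub>m)\<close> and \<open>b \<mapsto> a\<^sub>m \<sigma>\<^sup>m(b)\<close>, respectively. The
  first of these is a bijection of \<open>S\<close> because \<open>\<sigma>\<^sup>n(a\<^sub>m)\<close> is invertible; the second is one as soon
  as \<open>\<sigma>\<close> is bijective. Bijectivity on top coefficients is all that the usual division argument
  needs: surjectivity lets one cancel the top coefficient of \<open>g\<close> again and again until the degree
  is below \<open>m\<close>, and injectivity prevents a nonzero \<open>q\<close> from being sent below degree \<open>m\<close>.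
  Lemma \<open>division_by_top_coeff_bijective_map\<close> carries this out for an arbitrary additive map, so
  that the left and the right division are two instances of it.
\<close>

lemma remainder_condition_iff:
  "(r = 0 \<or> degree r < m) \<longleftrightarrow> (\<forall>i\<ge>m. coeff r i = 0)"
proof
  assume "\<forall>i\<ge>m. coeff r i = 0"
  then show "r = 0 \<or> degree r < m"
    using leading_coeff_0_iff not_less by blast
qed (auto simp: coeff_eq_0)

text \<open>
  The hypotheses state that \<open>M\<close> is triangular with respect to the filtration by degree, shifted by
  \<open>m\<close>, with the bijections \<open>\<phi> n\<close> on the diagonal. No product of polynomials occurs, which is what
  lets the lemma serve for multiplication by a fixed polynomial on either side.
\<close>

lemma division_by_top_coeff_bijective_map:
  fixes M :: "'a::ab_group_add poly \<Rightarrow> 'a poly" and \<phi> :: "nat \<Rightarrow> 'a \<Rightarrow> 'a"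
  assumes M: "Modules.additive M"
    and top: "\<And>q n. \<forall>i>n. coeff q i = 0 \<Longrightarrow> coeff (M q) (n + m) = \<phi> n (coeff q n)"
    and above: "\<And>q n i. \<forall>i>n. coeff q i = 0 \<Longrightarrow> i > n + m \<Longrightarrow> coeff (M q) i = 0"
    and bij: "\<And>n. bij (\<phi> n)"
  shows "\<exists>!(q, r). (r = 0 \<or> degree r < m) \<and> g = M q + r"
proof -
  interpret M: Modules.additive M by (rule M)
  have \<phi>0: "\<phi> n 0 = 0" for n
    using top[of n 0] by (simp add: M.zero)
  have division: "\<exists>q r. (\<forall>i\<ge>m. coeff r i = 0) \<and> h = M q + r"
    if "\<forall>i\<ge>k + m. coeff h i = 0" for k h
    using that
  proof (induction k arbitrary: h)
    case 0
    then show ?case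
      by (intro exI[of _ 0] exI[of _ h]) (simp add: M.zero)
  next
    case (Suc k)
    obtain b where b: "\<phi> k b = coeff h (k + m)"
      using bij[of k] by (metis bij_pointE)
    define q where "q = monom b k"
    have q: "\<forall>i>k. coeff q i = 0" by (simp add: q_def)
    have "coeff (h - M q) i = 0" if "i \<ge> k + m" for i
    proof (cases "i = k + m")
      case True
      then show ?thesis using top[OF q] by (simp add: b q_def)
    next
      case False
      with that show ?thesis using above[OF q, of i] Suc.prems by simp
    qed
    then obtain q' r where "\<forall>i\<ge>m. coeff r i = 0" "h - M q = M q' + r"
      using Suc.IH by blast
    then show ?case
      by (intro exI[of _ "q + q'"] exI[of _ r]) (simp add: M.add algebra_simps)
  qed
  have trivial_kernel: "d = 0" if low: "\<forall>i\<ge>m. coeff (M d) i = 0" for d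
  proof -
    have "\<phi> (degree d) (coeff d (degree d)) = \<phi> (degree d) 0"
      using top[of "degree d" d] low by (simp add: coeff_eq_0 \<phi>0)
    then have "coeff d (degree d) = 0"
      using bij[of "degree d"] by (simp add: bij_is_inj inj_eq)
    then show ?thesis by (simp add: leading_coeff_0_iff)
  qed
  have unique: "q = q' \<and> r = r'"
    if "\<forall>i\<ge>m. coeff r i = 0" "\<forall>i\<ge>m. coeff r' i = 0" "M q + r = M q' + r'" for q q' r r'
  proof -
    have "M (q - q') = r' - r"
      using that(3) by (simp add: M.diff algebra_simps)
    with that(1,2) have "q - q' = 0"
      by (intro trivial_kernel) simp
    with that(3) show ?thesis by simp
  qed
  have "\<forall>i\<ge>Suc (degree g) + m. coeff g i = 0"
    by (simp add: coeff_eq_0)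
  then obtain q r where "\<forall>i\<ge>m. coeff r i = 0" "g = M q + r"
    using division by blast
  then show ?thesis
    unfolding remainder_condition_iff
    by (intro ex1I[of _ "(q, r)"]) (auto dest: unique)
qed

lemma left_mult_t_pow_top_coeff:
  assumes \<sigma>\<delta>: "ring_endomorphism \<sigma>" "left_skew_derivation \<sigma> \<delta>"
    and q: "\<forall>i>n. coeff q i = 0"
  shows "coeff ((left_mult_t \<sigma> \<delta> ^^ k) q) (k + n) = (\<sigma> ^^ k) (coeff q n)"
    and "\<forall>i>k + n. coeff ((left_mult_t \<sigma> \<delta> ^^ k) q) i = 0"
proof -
  interpret s: Modules.additive \<sigma>
    using \<sigma>\<delta>(1) by (simp add: ring_endomorphism_def)
  interpret d: Modules.additive \<delta>
    using \<sigma>\<delta>(2) by (simp add: left_skew_derivation_def)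
  have "coeff ((left_mult_t \<sigma> \<delta> ^^ k) q) (k + n) = (\<sigma> ^^ k) (coeff q n) \<and>
      (\<forall>i>k + n. coeff ((left_mult_t \<sigma> \<delta> ^^ k) q) i = 0)"
    by (induction k)
      (auto simp: q coeff_left_mult_t[OF \<sigma>\<delta>] s.zero d.zero split: nat.split)
  then show "coeff ((left_mult_t \<sigma> \<delta> ^^ k) q) (k + n) = (\<sigma> ^^ k) (coeff q n)"
    and "\<forall>i>k + n. coeff ((left_mult_t \<sigma> \<delta> ^^ k) q) i = 0"
    by auto
qed

text \<open>
  In \<open>p q = \<Sum> p\<^sub>i (t\<^sup>i q)\<close> the summand for \<open>i\<close> has no coefficients above \<open>i + n\<close>, so that only
  \<open>i = k\<close> reaches \<open>k + n\<close>. The result is phrased with degree bounds because degrees themselves need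
  not add up when \<open>S\<close> has zero divisors.
\<close>

lemma skew_mult_top_coeff:
  assumes \<sigma>\<delta>: "ring_endomorphism \<sigma>" "left_skew_derivation \<sigma> \<delta>"
    and p: "\<forall>i>k. coeff p i = 0" and q: "\<forall>i>n. coeff q i = 0"
  shows "coeff (skew_mult \<sigma> \<delta> p q) (k + n) = coeff p k * (\<sigma> ^^ k) (coeff q n)"
    and "N > k + n \<Longrightarrow> coeff (skew_mult \<sigma> \<delta> p q) N = 0"
proof -
  let ?T = "left_mult_t \<sigma> \<delta>"
  have "degree p \<le> k" using p by (intro degree_le)
  then have coeff: "coeff (skew_mult \<sigma> \<delta> p q) N =
      (\<Sum>i\<le>k. coeff p i * coeff ((?T ^^ i) q) N)" for N
    by (simp add: skew_mult_bound coeff_sum coeff_left_scale)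
  note T = left_mult_t_pow_top_coeff[OF \<sigma>\<delta> q]
  have "(\<Sum>i\<le>k. coeff p i * coeff ((?T ^^ i) q) (k + n)) =
      (\<Sum>i\<in>{k}. coeff p i * coeff ((?T ^^ i) q) (k + n))"
    by (rule sum.mono_neutral_right) (auto simp: T(2))
  then show "coeff (skew_mult \<sigma> \<delta> p q) (k + n) = coeff p k * (\<sigma> ^^ k) (coeff q n)"
    by (simp add: coeff T(1))
  show "coeff (skew_mult \<sigma> \<delta> p q) N = 0" if "N > k + n"
    unfolding coeff using that by (intro sum.neutral) (auto simp: T(2))
qed

lemma two_sided_invertible_funpow:
  assumes "ring_endomorphism \<sigma>" and "two_sided_invertible a"
  shows "two_sided_invertible ((\<sigma> ^^ n) a)"
proof (induction n)
  case (Suc n)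
  then obtain b where "(\<sigma> ^^ n) a * b = 1" "b * (\<sigma> ^^ n) a = 1"
    by (auto simp: two_sided_invertible_def)
  with assms(1) have "\<sigma> ((\<sigma> ^^ n) a) * \<sigma> b = 1" "\<sigma> b * \<sigma> ((\<sigma> ^^ n) a) = 1"
    by (metis ring_endomorphism_def)+
  then show ?case by (auto simp: two_sided_invertible_def)
qed (use assms(2) in simp)

lemma bij_mult_two_sided_invertible:
  assumes "two_sided_invertible a"
  shows "bij (\<lambda>x. x * a)" and "bij (\<lambda>x. a * x)"
proof -
  obtain b where b: "a * b = 1" "b * a = 1"
    using assms by (auto simp: two_sided_invertible_def)
  show "bij (\<lambda>x. x * a)"
    by (rule bij_betw_byWitness[where f' = "\<lambda>x. x * b"]) (auto simp: b mult.assoc)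
  show "bij (\<lambda>x. a * x)"
    by (rule bij_betw_byWitness[where f' = "\<lambda>x. b * x"]) (auto simp: b simp flip: mult.assoc)
qed

theorem theorem7p1:
  fixes \<sigma> \<delta> :: "'a::{ring,monoid_mult} \<Rightarrow> 'a"
    and a :: "nat \<Rightarrow> 'a" and m :: nat and f :: "'a poly"
  assumes "ring_endomorphism \<sigma>" and "inj \<sigma>"
    and "left_skew_derivation \<sigma> \<delta>"
    and "f = monom (a m) m - (\<Sum>i<m. monom (a i) i)"
    and "two_sided_invertible (a m)"
  shows "(\<forall>g. \<exists>!(q, r). (r = 0 \<or> degree r < m) \<and> g = skew_mult \<sigma> \<delta> q f + r)
       \<and> (bij \<sigma> \<longrightarrow>
          (\<forall>g. \<exists>!(q, r). (r = 0 \<or> degree r < m) \<and> g = skew_mult \<sigma> \<delta> f q + r))"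
proof (intro conjI impI allI)
  note \<sigma>\<delta> = assms(1,3)
  have f_above: "\<forall>i>m. coeff f i = 0" and f_top: "coeff f m = a m"
    by (auto simp: assms(4) coeff_sum)
  fix g
  show "\<exists>!(q, r). (r = 0 \<or> degree r < m) \<and> g = skew_mult \<sigma> \<delta> q f + r"
  proof (rule division_by_top_coeff_bijective_map)
    show "Modules.additive (\<lambda>q. skew_mult \<sigma> \<delta> q f)"
      by unfold_locales (rule skew_mult_add_left)
    show "coeff (skew_mult \<sigma> \<delta> q f) (n + m) = coeff q n * (\<sigma> ^^ n) (a m)"
      if "\<forall>i>n. coeff q i = 0" for q n
      using skew_mult_top_coeff(1)[OF \<sigma>\<delta> that f_above] by (simp add: f_top)
    show "coeff (skew_mult \<sigma> \<delta> q f) i = 0" if "\<forall>i>n. coeff q i = 0" "i > n + m" for q n i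
      using skew_mult_top_coeff(2)[OF \<sigma>\<delta> that(1) f_above that(2)] .
    show "bij (\<lambda>x. x * (\<sigma> ^^ n) (a m))" for n
      by (intro bij_mult_two_sided_invertible two_sided_invertible_funpow assms)
  qed
  assume "bij \<sigma>"
  show "\<exists>!(q, r). (r = 0 \<or> degree r < m) \<and> g = skew_mult \<sigma> \<delta> f q + r"
  proof (rule division_by_top_coeff_bijective_map)
    show "Modules.additive (\<lambda>q. skew_mult \<sigma> \<delta> f q)"
      by unfold_locales (rule skew_mult_add_right[OF \<sigma>\<delta>])
    show "coeff (skew_mult \<sigma> \<delta> f q) (n + m) = a m * (\<sigma> ^^ m) (coeff q n)"
      if "\<forall>i>n. coeff q i = 0" for q n
      using skew_mult_top_coeff(1)[OF \<sigma>\<delta> f_above that] by (simp add: f_top add.commute)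
    show "coeff (skew_mult \<sigma> \<delta> f q) i = 0" if "\<forall>i>n. coeff q i = 0" "i > n + m" for q n i
      using skew_mult_top_coeff(2)[OF \<sigma>\<delta> f_above that(1)] that(2) by (simp add: add.commute)
    have "bij (\<sigma> ^^ m)"
      using \<open>bij \<sigma>\<close> by (induction m) (simp_all add: bij_comp)
    from bij_comp[OF this bij_mult_two_sided_invertible(2)[OF assms(5)]]
    show "bij (\<lambda>x. a m * (\<sigma> ^^ m) x)"
      by (simp add: o_def)
  qed
qed

end
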